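(* Let $H\in\mathbb{S}^n$, let $A\in\mathbb{R}^{m\times n}$ have full row rank with $m<n$, and let $Z\in\mathbb{R}^{n\times(n-m)}$ have orthonormal columns spanning $\mathcal{N}(A)$. Put $f(\rho):=\lambda_{\min}(H+\rho A^{\mathrm T}A)$, $\lambda_*:=\lambda_{\min}(Z^{\mathrm T}HZ)$, and $\mathcal{E}_*:=\mathcal{N}(Z^{\mathrm T}HZ-\lambda_*I_{n-m})$. Let $r:=\dim(\mathcal{E}_* )$ and let $W\in\mathbb{R}^{(n-m)\times r}$ have orthonormal columns spanning $\mathcal{E}_*$. Then, as $\rho\to+\infty$, $$f(\rho)=\lambda_*-\frac{c}{\rho}+O\left(\frac{1}{\rho^2}\right),$$ where $$c=\lambda_{\max}\left(W^{\mathrm T}Z^{\mathrm T}HA^{\mathrm T}(AA^{\mathrm T})^{-2}AHZW\right)=\max_{w\in\mathcal{E}_*,\ \|w\|=1}\left\|(AA^{\mathrm T})^{-1}AHZw\right\|^2 .$$ The coefficient $c$ is nonnegative, and $c=0$ if and only if the finite-attainability conditions (see context) hold. Hence, if the finite-attainability conditions fail, then $c>0$ and $$\lambda_*-f(\rho)=\frac{c}{\rho}+O\left(\frac{1}{\rho^2}\right)\qquad(\rho\to+\infty).$$ If $\lambda_*$ is a simple eigenvalue of $Z^{\mathrm T}HZ$, let $v_*$ be a corresponding unit eigenvector of $Z^{\mathrm T}HZ$ and set $x_*:=Zv_*$. Then $$c=(Hx_* )^{\mathrm T}A^{\mathrm T}(AA^{\mathrm T})^{-2}A(Hx_* )=\left\|(AA^{\mathrm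 T})^{-1}A(Hx_* )\right\|^2 .$$
   Context: $\mathbb{S}^n$ denotes the space of $n\times n$ real symmetric matrices, $\mathcal{N}(\cdot)$ the null space, $\lambda_{\min}(M)$ and $\lambda_{\max}(M)$ the smallest and largest eigenvalues of a symmetric matrix $M$, and $\|\cdot\|$ the Euclidean norm for vectors. The finite-attainability conditions are the following three mutually equivalent conditions, where $K:=H-\lambda_*I_n$: (i) there exists a finite $\rho^*\in\mathbb{R}$ with $f(\rho^* )=\lambda_*$; (ii) $KZw=0$ for every $w\in\mathcal{E}_*$; (iii) $\mathcal{N}(Z^{\mathrm T}KZ)=\mathcal{N}(Z^{\mathrm T}K^2Z)$. *)

theory Defs
  imports
    "HOL-Analysis.Analysis"
    "HOL-Computational_Algebra.Polynomial"
    "HOL-Library.Landau_Symbols"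
begin

definition null_space :: "real^'n^'m \<Rightarrow> (real^'n) set" where
  "null_space M = {x. M *v x = 0}"

definition orthonormal_columns :: "real^'k^'n \<Rightarrow> bool" where
  "orthonormal_columns M \<longleftrightarrow>
     (\<forall>i j. column i M \<bullet> column j M = (if i = j then 1 else 0))"

definition eigenvalues :: "real^'n^'n \<Rightarrow> real set" where
  "eigenvalues M = {l. \<exists>v. v \<noteq> 0 \<and> M *v v = l *\<^sub>R v}"

(* For symmetric M the set of real eigenvalues is finite and nonempty, so Min and Max
   below are genuine; neither function is meaningful for matrices without real eigenvalues. *)
definition lambda_min :: "real^'n^'n \<Rightarrow> real" where
  "lambda_min M = Min (eigenvalues M)"

definition lambda_max :: "real^'n^'n \<Rightarrow> real" where
  "lambda_max M = Max (eigenvalues M)"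

(* det (x I - M), computed over the ring of real polynomials in x *)
definition char_poly :: "real^'n^'n \<Rightarrow> real poly" where
  "char_poly M = det (\<chi> i j. (if i = j then [:0, 1:] else 0) - [:M $ i $ j:])"

(* simple: algebraic multiplicity one *)
definition simple_eigenvalue :: "real^'n^'n \<Rightarrow> real \<Rightarrow> bool" where
  "simple_eigenvalue M l \<longleftrightarrow> l \<in> eigenvalues M \<and> order l (char_poly M) = 1"

(* HOL's Max is only meaningful on finite sets; this is the maximum of an arbitrary set. *)
definition is_maximum :: "real \<Rightarrow> real set \<Rightarrow> bool" where
  "is_maximum c S \<longleftrightarrow> c \<in> S \<and> (\<forall>x\<in>S. x \<le> c)"

definition penalty_value :: "real^'n^'n \<Rightarrow> real^'n^'m \<Rightarrow> real \<Rightarrow> real" where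
  "penalty_value H A \<rho> = lambda_min (H + \<rho> *\<^sub>R (transpose A ** A))"

definition reduced_matrix :: "real^'n^'n \<Rightarrow> real^'k^'n \<Rightarrow> real^'k^'k" where
  "reduced_matrix H Z = transpose Z ** H ** Z"

definition reduced_value :: "real^'n^'n \<Rightarrow> real^'k^'n \<Rightarrow> real" where
  "reduced_value H Z = lambda_min (reduced_matrix H Z)"

definition reduced_eigenspace :: "real^'n^'n \<Rightarrow> real^'k^'n \<Rightarrow> (real^'k) set" where
  "reduced_eigenspace H Z = null_space (reduced_matrix H Z - reduced_value H Z *\<^sub>R mat 1)"

definition shifted_matrix :: "real^'n^'n \<Rightarrow> real^'k^'n \<Rightarrow> real^'n^'n" where
  "shifted_matrix H Z = H - reduced_value H Z *\<^sub>R mat 1"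

(* The three finite-attainability conditions. Their mutual equivalence is not built in. *)
definition attained_at_finite_parameter ::
  "real^'n^'n \<Rightarrow> real^'n^'m \<Rightarrow> real^'k^'n \<Rightarrow> bool" where
  "attained_at_finite_parameter H A Z \<longleftrightarrow> (\<exists>\<rho>. penalty_value H A \<rho> = reduced_value H Z)"

definition shifted_matrix_annihilates :: "real^'n^'n \<Rightarrow> real^'k^'n \<Rightarrow> bool" where
  "shifted_matrix_annihilates H Z \<longleftrightarrow>
     (\<forall>w \<in> reduced_eigenspace H Z. (shifted_matrix H Z ** Z) *v w = 0)"

definition null_spaces_agree :: "real^'n^'n \<Rightarrow> real^'k^'n \<Rightarrow> bool" where
  "null_spaces_agree H Z \<longleftrightarrow>
     (let K = shifted_matrix H Z
      in null_space (transpose Z ** K ** Z) = null_space (transpose Z ** (K ** K) ** Z))"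

end

theory Submission
  imports Defs
begin

text \<open>
  Since \<open>A Z = 0\<close> and \<open>A\<close> has full row rank, every \<open>x\<close> is an orthogonal sum
  \<open>x = Z u + A\<^sup>T B a\<close> with \<open>a = A x\<close> and \<open>B = (A A\<^sup>T)\<^sup>-\<^sup>1\<close>.  With \<open>M = Z\<^sup>T H Z\<close> and
  \<open>T = B A H Z\<close> the penalized quadratic form becomes
  \<open>u \<bullet> M u + 2 a \<bullet> T u + O(|a|\<^sup>2) + \<rho> |a|\<^sup>2\<close>.  Splitting \<open>u = s + w\<close> with \<open>w\<close> in the
  eigenspace \<open>E\<close> and \<open>s\<close> orthogonal to it, the spectral gap of \<open>M\<close> absorbs all terms in \<open>s\<close>,
  and completing the square in \<open>a\<close> leaves \<open>- |T w|\<^sup>2 / \<rho>\<close>.  This bounds the smallest eigenvalue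
  below by \<open>lam - c / \<rho> - c C / \<rho>\<^sup>2\<close>, where \<open>c\<close> is the maximum of \<open>|T w|\<^sup>2\<close> over unit
  vectors of \<open>E\<close>; the optimal \<open>a = - T w / \<rho>\<close> gives the matching upper bound.  Because the
  error term also carries the factor \<open>c\<close>, the value \<open>lam\<close> is attained at a finite parameter
  when \<open>c = 0\<close>.
\<close>

subsection \<open>Extreme eigenvalues of symmetric matrices\<close>

lemma inner_transpose_mult:
  fixes M :: "real^'n^'m"
  shows "(transpose M *v x) \<bullet> y = x \<bullet> (M *v y)"
  by (simp add: transpose_matrix_vector dot_lmul_matrix)

text \<open>As a simp rule it would turn \<open>transpose M *v x\<close> into \<open>x v* M\<close>,
  a form to which the adjoint identity above no longer applies.\<close>

declare transpose_matrix_vector [simp del]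

lemma symmetric_inner_commute:
  fixes M :: "real^'n^'n"
  assumes "transpose M = M"
  shows "(M *v x) \<bullet> y = x \<bullet> (M *v y)"
  using inner_transpose_mult[of M x y] assms by simp

text \<open>Near \<open>t = 0\<close> a nonzero linear term dominates the quadratic one and changes
  sign with \<open>t\<close>. This is the first-order optimality condition used for quadratic
  forms.\<close>

lemma nonneg_quadratic_linear_coeff:
  fixes a b :: real
  assumes "\<And>t. 0 \<le> 2 * t * a + t\<^sup>2 * b"
  shows "a = 0"
proof (rule ccontr)
  assume "a \<noteq> 0"
  \<comment> \<open>At \<open>t = - a / d\<close> the polynomial equals
    \<open>(a / d)^2 * (b - 2 * d)\<close>, which is negative because \<open>d\<close> is positive
    and exceeds \<open>b\<close>.\<close>
  define d where "d = 1 + \<bar>b\<bar>"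
  have d: "d > 0" "b < d" by (auto simp: d_def)
  have "0 \<le> 2 * (- a / d) * a + (- a / d)\<^sup>2 * b" by (rule assms)
  also have "\<dots> = (a / d)\<^sup>2 * (b - 2 * d)"
    using d by (simp add: field_simps power2_eq_square)
  also have "\<dots> < 0"
    using d \<open>a \<noteq> 0\<close> by (intro mult_pos_neg) auto
  finally show False by simp
qed

text \<open>A zero \<open>v\<close> of a nonnegative form is a minimizer, so every directional
  derivative there vanishes; in the direction \<open>g = M *v v\<close> the derivative is twice
  \<open>g \<bullet> g\<close>.\<close>

lemma psd_null_vector:
  fixes M :: "real^'n^'n"
  assumes sym: "transpose M = M" and psd: "\<And>x. 0 \<le> x \<bullet> (M *v x)" and v: "v \<bullet> (M *v v) = 0"
  shows "M *v v = 0"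
proof -
  define g where "g = M *v v"
  have "0 \<le> 2 * t * (g \<bullet> g) + t\<^sup>2 * (g \<bullet> (M *v g))" for t
  proof -
    have "0 \<le> (v + t *\<^sub>R g) \<bullet> (M *v (v + t *\<^sub>R g))" by (rule psd)
    also have "\<dots> = v \<bullet> (M *v v) + t * (v \<bullet> (M *v g)) + t * (g \<bullet> (M *v v)) + t\<^sup>2 * (g \<bullet> (M *v g))"
      by (simp add: matrix_vector_right_distrib matrix_vector_mult_scaleR inner_simps
          algebra_simps power2_eq_square)
    also have "v \<bullet> (M *v g) = g \<bullet> g"
      by (simp add: symmetric_inner_commute[OF sym, symmetric] g_def)
    finally show ?thesis by (simp add: v g_def)
  qed
  then have "g \<bullet> g = 0" by (rule nonneg_quadratic_linear_coeff)
  then show ?thesis by (simp add: g_def)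
qed

lemma transpose_diff_scaled_mat:
  fixes M :: "real^'n^'n"
  assumes "transpose M = M"
  shows "transpose (M - l *\<^sub>R mat 1) = M - l *\<^sub>R mat 1"
  using assms by (simp add: transpose_def vec_eq_iff mat_def eq_commute)

lemma diff_scaled_mat_mult:
  fixes M :: "real^'n^'n"
  shows "(M - l *\<^sub>R mat 1) *v x = M *v x - l *\<^sub>R x"
  by (simp add: matrix_vector_mult_diff_rdistrib scaleR_matrix_vector_assoc[symmetric])

text \<open>The shifted matrix \<open>M - l *\<^sub>R mat 1\<close> is positive semidefinite and its
  form vanishes at \<open>v\<close>, so \<open>v\<close> lies in its kernel.\<close>

lemma rayleigh_minimizer_eigenvector:
  fixes M :: "real^'n^'n"
  assumes sym: "transpose M = M" and le: "\<And>x. l * (norm x)\<^sup>2 \<le> x \<bullet> (M *v x)"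
    and v: "v \<bullet> (M *v v) = l * (norm v)\<^sup>2"
  shows "M *v v = l *\<^sub>R v"
proof -
  have "(M - l *\<^sub>R mat 1) *v v = 0"
    by (rule psd_null_vector[OF transpose_diff_scaled_mat[OF sym]])
      (use le v in \<open>auto simp: diff_scaled_mat_mult inner_simps power2_norm_eq_inner\<close>)
  then show ?thesis by (simp add: diff_scaled_mat_mult)
qed

lemma rayleigh_minimum_exists:
  fixes M :: "real^'n^'n"
  obtains l v where "norm v = 1" "v \<bullet> (M *v v) = l" "\<And>x. l * (norm x)\<^sup>2 \<le> x \<bullet> (M *v x)"
proof -
  have "continuous_on (sphere 0 1) (\<lambda>x. x \<bullet> (M *v x))"
    by (intro continuous_intros matrix_vector_mult_linear_continuous_on)
  moreover have "sphere (0::real^'n) 1 \<noteq> {}" by (simp)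
  ultimately obtain v where v: "v \<in> sphere 0 1"
    and min: "\<And>x. x \<in> sphere 0 1 \<Longrightarrow> v \<bullet> (M *v v) \<le> x \<bullet> (M *v x)"
    using continuous_attains_inf[of "sphere 0 1" "\<lambda>x. x \<bullet> (M *v x)"] compact_sphere by blast
  have "v \<bullet> (M *v v) * (norm x)\<^sup>2 \<le> x \<bullet> (M *v x)" for x
  proof (cases "x = 0")
    case False
    then have "v \<bullet> (M *v v) \<le> (x /\<^sub>R norm x) \<bullet> (M *v (x /\<^sub>R norm x))"
      by (intro min) simp
    also have "\<dots> = x \<bullet> (M *v x) / (norm x)\<^sup>2"
      by (simp add: matrix_vector_mult_scaleR power2_eq_square field_simps)
    finally show ?thesis using False by (simp add: field_simps)
  qed simp
  with v show thesis by (intro that[of v]) auto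
qed

lemma eigenvalue_eq_rayleigh:
  fixes M :: "real^'n^'n"
  assumes "l \<in> eigenvalues M"
  obtains v where "norm v = 1" "M *v v = l *\<^sub>R v" "v \<bullet> (M *v v) = l"
proof -
  obtain u where u: "u \<noteq> 0" "M *v u = l *\<^sub>R u"
    using assms by (auto simp: eigenvalues_def)
  define v where "v = u /\<^sub>R norm u"
  have "norm v = 1" using u by (simp add: v_def)
  moreover have Mv: "M *v v = l *\<^sub>R v"
    using u by (simp add: v_def matrix_vector_mult_scaleR)
  moreover have "v \<bullet> (M *v v) = l"
    using \<open>norm v = 1\<close> by (simp add: Mv flip: power2_norm_eq_inner)
  ultimately show thesis by (rule that)
qed

text \<open>Eigenvectors for distinct eigenvalues are orthogonal, hence independent, and independent
  sets are finite. Finiteness is what gives \<open>Min\<close> and \<open>Max\<close> of the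
  spectrum their meaning.\<close>

lemma finite_eigenvalues:
  fixes M :: "real^'n^'n"
  assumes sym: "transpose M = M"
  shows "finite (eigenvalues M)"
proof -
  define v where "v l = (SOME v. norm v = 1 \<and> M *v v = l *\<^sub>R v)" for l
  have v: "norm (v l) = 1" "M *v v l = l *\<^sub>R v l" if "l \<in> eigenvalues M" for l
  proof -
    have "\<exists>v. norm v = 1 \<and> M *v v = l *\<^sub>R v"
      using eigenvalue_eq_rayleigh[OF that] by metis
    from someI_ex[OF this] show "norm (v l) = 1" "M *v v l = l *\<^sub>R v l" by (auto simp: v_def)
  qed
  have orth: "v l \<bullet> v k = 0" if "l \<in> eigenvalues M" "k \<in> eigenvalues M" "l \<noteq> k" for l k
    using symmetric_inner_commute[OF sym, of "v l" "v k"] v[OF that(1)] v[OF that(2)] that(3) by simp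
  have inj: "inj_on v (eigenvalues M)"
  proof (rule inj_onI, rule ccontr)
    fix l k assume *: "l \<in> eigenvalues M" "k \<in> eigenvalues M" "v l = v k" "l \<noteq> k"
    then have "v l \<bullet> v l = 0" using orth[of l k] by simp
    with v(1)[OF *(1)] show False by simp
  qed
  have "pairwise orthogonal (v ` eigenvalues M)"
    using orth by (auto simp: pairwise_def orthogonal_def)
  then have "independent (v ` eigenvalues M)"
    using v(1) by (intro pairwise_orthogonal_independent) force+
  then show ?thesis
    using inj finite_imageD independent_imp_finite by blast
qed

text \<open>The minimum of the Rayleigh quotient is itself an eigenvalue, and every eigenvalue is a
  value of that quotient, so this minimum is the least eigenvalue.\<close>

lemma
  fixes M :: "real^'n^'n"
  assumes sym: "transpose M = M"
  shows lambda_min_in_eigenvalues: "lambda_min M \<in> eigenvalues M"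
    and lambda_min_rayleigh_le: "lambda_min M * (norm x)\<^sup>2 \<le> x \<bullet> (M *v x)"
proof -
  obtain l v where v: "norm v = 1" "v \<bullet> (M *v v) = l"
    and le: "\<And>x. l * (norm x)\<^sup>2 \<le> x \<bullet> (M *v x)"
    using rayleigh_minimum_exists[of M] by blast
  have "M *v v = l *\<^sub>R v"
    by (rule rayleigh_minimizer_eigenvector[OF sym le]) (simp add: v)
  then have l: "l \<in> eigenvalues M"
    using v by (auto simp: eigenvalues_def intro!: exI[of _ v])
  have "l \<le> k" if k: "k \<in> eigenvalues M" for k
  proof -
    obtain u where "norm u = 1" "u \<bullet> (M *v u) = k" by (rule eigenvalue_eq_rayleigh[OF k])
    with le[of u] show ?thesis by simp
  qed
  then have "lambda_min M = l"
    unfolding lambda_min_def by (intro Min_eqI finite_eigenvalues sym l)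
  with l le show "lambda_min M \<in> eigenvalues M" "lambda_min M * (norm x)\<^sup>2 \<le> x \<bullet> (M *v x)" by simp_all
qed

text \<open>Negating the matrix reflects its spectrum, which reduces the largest eigenvalue to the
  variational facts about the smallest.\<close>

lemma lambda_max_eqI:
  fixes M :: "real^'n^'n"
  assumes sym: "transpose M = M"
    and max: "is_maximum c {y \<bullet> (M *v y) | y. norm y = 1}"
  shows "lambda_max M = c"
proof -
  obtain v where v: "norm v = 1" "v \<bullet> (M *v v) = c"
    using max by (auto simp: is_maximum_def)
  have neg: "(- M) *v x = - (M *v x)" for x
    using matrix_vector_mult_diff_rdistrib[of 0 M x] by simp
  have "eigenvalues (- M) = uminus ` eigenvalues M"
  proof -
    have "- a = b \<longleftrightarrow> a = - b" for a b :: "real^'n"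
      by (metis minus_minus)
    then have "l \<in> eigenvalues (- M) \<longleftrightarrow> - l \<in> eigenvalues M" for l
      by (simp add: eigenvalues_def neg)
    then show ?thesis by (force simp: image_iff minus_equation_iff)
  qed
  moreover have sym': "transpose (- M) = - M"
    using sym by (simp add: transpose_def vec_eq_iff)
  moreover have "eigenvalues M \<noteq> {}" using lambda_min_in_eigenvalues[OF sym] by auto
  ultimately have eq: "lambda_min (- M) = - lambda_max M"
    using finite_eigenvalues[OF sym] by (simp add: lambda_min_def lambda_max_def minus_Max_eq_Min)
  have "c \<le> lambda_max M"
    using lambda_min_rayleigh_le[OF sym', of v] v by (simp add: eq neg)
  moreover have "lambda_max M \<le> c"
  proof -
    have "- lambda_max M \<in> eigenvalues (- M)"
      using lambda_min_in_eigenvalues[OF sym'] by (simp add: eq)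
    then obtain u where "norm u = 1" "u \<bullet> ((- M) *v u) = - lambda_max M"
      by (rule eigenvalue_eq_rayleigh)
    with max show ?thesis by (auto simp: is_maximum_def neg)
  qed
  ultimately show ?thesis by simp
qed

text \<open>The form attains its minimum on the compact set of unit vectors orthogonal to the
  kernel. A minimum of zero would put the minimizer in the kernel and make it orthogonal to
  itself.\<close>

lemma psd_spectral_gap:
  fixes M :: "real^'n^'n"
  assumes sym: "transpose M = M" and psd: "\<And>x. 0 \<le> x \<bullet> (M *v x)"
  obtains d where "d > 0" "\<And>s. (\<forall>w\<in>null_space M. s \<bullet> w = 0) \<Longrightarrow> d * (norm s)\<^sup>2 \<le> s \<bullet> (M *v s)"
proof -
  define S where "S = sphere 0 1 \<inter> {s. \<forall>w\<in>null_space M. s \<bullet> w = 0}"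
  have "S = sphere 0 1 \<inter> (\<Inter>w\<in>null_space M. {s. w \<bullet> s = 0})"
    by (auto simp: S_def inner_commute)
  then have "compact S"
    by (auto intro!: closed_hyperplane)
  have "\<exists>d>0. \<forall>s\<in>S. d \<le> s \<bullet> (M *v s)"
  proof (cases "S = {}")
    \<comment> \<open>With no unit vector orthogonal to the kernel, any positive constant
      works.\<close>
    case True
    then show ?thesis by (auto intro: exI[of _ 1])
  next
    case False
    have "continuous_on S (\<lambda>x. x \<bullet> (M *v x))"
      by (intro continuous_intros matrix_vector_mult_linear_continuous_on)
    then obtain v where v: "v \<in> S" and min: "\<And>s. s \<in> S \<Longrightarrow> v \<bullet> (M *v v) \<le> s \<bullet> (M *v s)"
      using continuous_attains_inf[of S "\<lambda>x. x \<bullet> (M *v x)"] \<open>compact S\<close> False by blast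
    have "v \<bullet> (M *v v) \<noteq> 0"
    proof
      assume "v \<bullet> (M *v v) = 0"
      then have "v \<in> null_space M"
        using psd_null_vector[OF sym psd] by (simp add: null_space_def)
      then have "v \<bullet> v = 0" using v by (simp add: S_def)
      then show False using v by (simp add: S_def)
    qed
    then show ?thesis using min psd[of v] by (intro exI[of _ "v \<bullet> (M *v v)"]) auto
  qed
  then obtain d where d: "d > 0" "\<And>s. s \<in> S \<Longrightarrow> d \<le> s \<bullet> (M *v s)" by blast
  show thesis
  proof (rule that[OF d(1)])
    fix s assume s: "\<forall>w\<in>null_space M. s \<bullet> w = 0"
    show "d * (norm s)\<^sup>2 \<le> s \<bullet> (M *v s)"
    proof (cases "s = 0")
      case False
      have "d \<le> (s /\<^sub>R norm s) \<bullet> (M *v (s /\<^sub>R norm s))"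
        using False s by (intro d) (simp add: S_def)
      also have "\<dots> = s \<bullet> (M *v s) / (norm s)\<^sup>2"
        by (simp add: matrix_vector_mult_scaleR power2_eq_square field_simps)
      finally show ?thesis using False by (simp add: field_simps)
    qed simp
  qed
qed

subsection \<open>Simple eigenvalues\<close>

text \<open>Evaluation at \<open>x\<close> is a ring homomorphism and so passes through the Leibniz
  expansion of the determinant.\<close>

lemma poly_char_poly:
  fixes M :: "real^'n^'n"
  shows "poly (char_poly M) x = det (x *\<^sub>R mat 1 - M)"
  unfolding char_poly_def det_def
  by (simp add: poly_sum poly_prod mat_def if_distrib cong: if_cong)
    (intro sum.cong refl, simp add: poly_prod sign_def, intro conjI impI prod.cong, auto)

text \<open>Multiplying by a basis matrix with rows \<open>u\<close> and \<open>v\<close> shows that two independent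
  eigenvectors would factor \<open>(x - l)\<^sup>2\<close> out of the characteristic polynomial.\<close>

lemma simple_eigenvalue_eigenvectors_dependent:
  fixes M :: "real^'n^'n"
  assumes sym: "transpose M = M" and simple: "simple_eigenvalue M l"
    and u: "M *v u = l *\<^sub>R u" and v: "M *v v = l *\<^sub>R v" and "u \<noteq> v"
  shows "dependent {u, v}"
proof (rule ccontr)
  assume ind: "\<not> dependent {u, v}"
  define B where "B = extend_basis {u, v}"
  have B: "independent B" "span B = UNIV" "{u, v} \<subseteq> B"
    using ind extend_basis_superset[OF ind]
    unfolding B_def by (simp_all add: independent_extend_basis)
  have "finite B" using B(1) by (rule independent_imp_finite)
  moreover have "card B = CARD('n)"
    using B by (metis dim_eq_card_independent dim_span dim_UNIV DIM_cart DIM_real mult.right_neutral)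
  ultimately obtain h :: "'n \<Rightarrow> real^'n" where h: "bij_betw h UNIV B"
    using finite_same_card_bij[of "UNIV :: 'n set" B] by auto
  obtain i j where ij: "h i = u" "h j = v"
    using h B(3) by (metis bij_betw_imp_surj_on imageE insert_subset)
  then have "i \<noteq> j" using \<open>u \<noteq> v\<close> by auto
  define P where "P = (\<chi> a. h a)"
  have rowsP: "rows P = B"
    using h by (auto simp: rows_def P_def row_def bij_betw_def vec_lambda_eta)
  have "det P \<noteq> 0"
  proof
    assume "det P = 0"
    then have "rank P < CARD('n)" by (simp add: det_eq_0_rank)
    moreover have "rank P = CARD('n)"
      by (metis row_rank_def rowsP dim_span B(2) dim_UNIV DIM_cart DIM_real mult.right_neutral)
    ultimately show False by simp
  qed
  \<comment> \<open>\<open>R x\<close> is \<open>P ** (x *\<^sub>R mat 1 - M)\<close> after the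
    factor \<open>x - l\<close> has been pulled out of rows \<open>i\<close> and
    \<open>j\<close>.\<close>
  define R where "R x = (\<chi> a. if a = i then u else if a = j then v else (x *\<^sub>R mat 1 - M) *v h a)" for x
  have fac: "det (x *\<^sub>R mat 1 - M) * det P = (x - l)\<^sup>2 * det (R x)" for x
  proof -
    define N where "N = x *\<^sub>R mat 1 - M"
    have symN: "transpose N = N"
      using sym by (simp add: N_def transpose_def vec_eq_iff mat_def eq_commute)
    have Nm: "N *v y = x *\<^sub>R y - M *v y" for y
      by (simp add: N_def matrix_vector_mult_diff_rdistrib scaleR_matrix_vector_assoc[symmetric])
    \<comment> \<open>Rows of \<open>P ** N\<close> are \<open>h a v* N\<close>; symmetry of
      \<open>N\<close> turns them into images of the basis vectors, so eigenvectors give multiples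
      of rows.\<close>
    have "P ** N = (\<chi> a. N *v h a)"
    proof -
      have "row a (P ** N) = N *v h a" for a
      proof -
        have "(P ** N) $ a = h a v* N"
          by (simp add: vec_eq_iff matrix_matrix_mult_def vector_matrix_mult_def P_def mult.commute)
        also have "\<dots> = N *v h a"
          using transpose_matrix_vector[of N "h a"] symN by simp
        finally show ?thesis by (simp add: row_def vec_lambda_eta)
      qed
      then show ?thesis by (simp add: row_def vec_lambda_eta vec_eq_iff)
    qed
    also have "\<dots> = (\<chi> a. if a = i then (x - l) *s u else (if a = j then (x - l) *s v else N *v h a))"
      by (simp add: vec_eq_iff ij Nm u v algebra_simps)
    also have "det \<dots> = (x - l) * det (\<chi> a. if a = i then u else (if a = j then (x - l) *s v else N *v h a))"
      by (rule det_row_mul)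
    \<comment> \<open>The two cases are swapped so that row \<open>j\<close> is tested first, the
      shape in which \<open>det_row_mul\<close> extracts the second factor.\<close>
    also have "(\<chi> a. if a = i then u else (if a = j then (x - l) *s v else N *v h a)) =
        (\<chi> a. if a = j then (x - l) *s v else (if a = i then u else N *v h a))"
      using \<open>i \<noteq> j\<close> by (simp add: vec_eq_iff)
    also have "det \<dots> = (x - l) * det (\<chi> a. if a = j then v else (if a = i then u else N *v h a))"
      by (rule det_row_mul)
    also have "(\<chi> a. if a = j then v else (if a = i then u else N *v h a)) = R x"
      using \<open>i \<noteq> j\<close> by (simp add: vec_eq_iff R_def N_def)
    finally show ?thesis by (simp add: det_mul N_def power2_eq_square mult.commute)
  qed
  have contR: "continuous_on UNIV (\<lambda>x. det (R x))"
  proof -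
    have "continuous_on UNIV (\<lambda>x. R x $ a $ b)" for a b
    proof -
      have "R x $ a $ b = (if a = i then u $ b else if a = j then v $ b
          else x * h a $ b - (M *v h a) $ b)" for x
        by (simp add: R_def matrix_vector_mult_diff_rdistrib scaleR_matrix_vector_assoc[symmetric])
      then show ?thesis
        by (cases "a = i"; cases "a = j") (auto intro!: continuous_intros)
    qed
    then show ?thesis unfolding det_def
      by (intro continuous_on_sum continuous_on_mult continuous_on_prod continuous_on_const)
  qed
  \<comment> \<open>Decomposing by \<open>order\<close> requires a nonzero polynomial. A zero one
    would make every real number an eigenvalue, although the spectrum is finite.\<close>
  have nz: "char_poly M \<noteq> 0"
  proof
    assume 0: "char_poly M = 0"
    obtain x where x: "x \<notin> eigenvalues M"
      using ex_new_if_finite[OF infinite_UNIV_char_0 finite_eigenvalues[OF sym]] by blast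
    have "det (x *\<^sub>R mat 1 - M) = 0"
      using 0 by (simp flip: poly_char_poly)
    then obtain y where "y \<noteq> 0" "(x *\<^sub>R mat 1 - M) *v y = 0"
      using matrix_nonfull_linear_equations_eq[of "x *\<^sub>R mat 1 - M"]
        det_eq_0_rank[of "x *\<^sub>R mat 1 - M"] by auto
    then have "x \<in> eigenvalues M"
      by (auto simp: eigenvalues_def matrix_vector_mult_diff_rdistrib
          scaleR_matrix_vector_assoc[symmetric] intro!: exI[of _ y])
    with x show False by simp
  qed
  have ord: "order l (char_poly M) = 1"
    using simple by (auto simp: simple_eigenvalue_def)
  obtain q where q: "char_poly M = [:- l, 1:] * q" "poly q l \<noteq> 0"
    using order_decomp[OF nz, of l] by (auto simp: ord poly_eq_0_iff_dvd)
  \<comment> \<open>\<open>D\<close> is what remains of the factorization after one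
    \<open>x - l\<close> is cancelled. It vanishes away from \<open>l\<close>, hence by continuity
    also at \<open>l\<close>, where its value is \<open>poly q l * det P\<close>, a nonzero
    number.\<close>
  define D where "D x = poly q x * det P - (x - l) * det (R x)" for x
  have "(x - l) * D x = 0" for x
    using fac[of x] unfolding poly_char_poly[symmetric] q(1)
    by (simp add: D_def algebra_simps power2_eq_square)
  then have "D x = 0" if "x \<noteq> l" for x
    using that by (metis mult_eq_0_iff right_minus_eq)
  then have "(D \<longlongrightarrow> 0) (at l)"
    by (intro tendsto_eventually eventually_at_filter[THEN iffD2] always_eventually) auto
  moreover have "continuous_on UNIV D"
    unfolding D_def by (intro continuous_intros contR)
  then have "(D \<longlongrightarrow> D l) (at l)"
    by (simp add: continuous_on_eq_continuous_at isContD)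
  ultimately have "D l = 0"
    using tendsto_unique by (metis at_neq_bot)
  then show False using q(2) \<open>det P \<noteq> 0\<close> by (simp add: D_def)
qed

subsection \<open>Quadratic estimates\<close>

lemma range_eq_span_columns:
  fixes M :: "real^'k^'n"
  shows "range ((*v) M) = span (columns M)"
proof
  show "range ((*v) M) \<subseteq> span (columns M)"
    by (auto intro: matrix_vector_mult_in_columnspace)
  have "columns M \<subseteq> range ((*v) M)"
    using columns_image_basis[of M] by auto
  moreover have "subspace (range ((*v) M))"
    by (intro linear_subspace_image matrix_vector_mul_linear subspace_UNIV)
  ultimately show "span (columns M) \<subseteq> range ((*v) M)" by (rule span_minimal)
qed

lemma orthonormal_columns_iff:
  "orthonormal_columns (M :: real^'k^'n) \<longleftrightarrow> transpose M ** M = mat 1"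
  by (auto simp: orthonormal_columns_def vec_eq_iff matrix_matrix_mult_def transpose_def
      column_def inner_vec_def mat_def)

lemma orthonormal_columns_norm:
  fixes M :: "real^'k^'n"
  assumes "orthonormal_columns M"
  shows "norm (M *v x) = norm x"
proof -
  have "(M *v x) \<bullet> (M *v x) = (transpose M *v (M *v x)) \<bullet> x"
    by (simp only: inner_transpose_mult)
  also have "\<dots> = x \<bullet> x"
    using assms by (simp add: orthonormal_columns_iff matrix_vector_mul_assoc)
  finally show ?thesis by (simp add: norm_eq)
qed

lemma matrix_vector_mult_bound:
  fixes M :: "real^'n^'m"
  obtains K where "K > 0" "\<And>x. norm (M *v x) \<le> K * norm x"
proof -
  obtain K where "K > 0" "\<And>x. norm (M *v x) \<le> norm x * K"
    using bounded_linear.pos_bounded[OF matrix_vector_mul_bounded_linear[of M]] by blast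
  then show thesis by (intro that[of K]) (simp_all add: mult.commute)
qed

text \<open>Young's inequality with a free weight, obtained by expanding the squared norm of
  \<open>e *\<^sub>R x - y\<close>.\<close>

lemma two_inner_le_weighted:
  fixes x y :: "'a::real_inner"
  assumes "e > 0"
  shows "2 * (x \<bullet> y) \<le> e * (norm x)\<^sup>2 + (norm y)\<^sup>2 / e"
proof -
  have "0 \<le> (norm (e *\<^sub>R x - y))\<^sup>2 / e" using assms by simp
  also have "\<dots> = e * (norm x)\<^sup>2 + (norm y)\<^sup>2 / e - 2 * (x \<bullet> y)"
    using assms unfolding power2_norm_eq_inner
    by (simp add: inner_simps inner_commute field_simps)
  finally show ?thesis by simp
qed

text \<open>In the application \<open>g = T *v w\<close> and \<open>t = T *v s\<close>, while
  \<open>\<omega>\<close> and \<open>\<sigma>\<close> are the squared norms of \<open>w\<close> and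
  \<open>s\<close>. Completing the square in \<open>a\<close> produces the loss
  \<open>(norm g)^2 / \<rho>\<close>; all other cross terms are absorbed by
  \<open>\<delta> * \<sigma>\<close>, by the square itself, or by the second-order error.\<close>

lemma completed_square_bound:
  fixes a g t :: "'a::real_inner" and \<rho> :: real
  assumes g: "(norm g)\<^sup>2 \<le> c * \<omega>" and t: "(norm t)\<^sup>2 \<le> \<tau> * \<sigma>"
    and pos: "\<delta> > 0" "\<tau> > 0" "\<kappa> \<ge> 0" "\<rho> > 0" and \<rho>: "\<rho> \<ge> 2 * \<kappa> + 4 * \<tau> / \<delta>" and \<sigma>: "\<sigma> \<ge> 0"
  shows "0 \<le> \<delta> * \<sigma> + 2 * (a \<bullet> (g + t)) - \<kappa> * (norm a)\<^sup>2 + \<rho> * (norm a)\<^sup>2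
      + (c / \<rho> + c * (2 * \<kappa> + 4 * \<tau> / \<delta>) / \<rho>\<^sup>2) * \<omega>"
proof -
  define C where "C = 2 * \<kappa> + 4 * \<tau> / \<delta>"
  \<comment> \<open>This Young weight makes each of the two cross terms with \<open>t\<close> cost
    at most a quarter of \<open>\<delta> * \<sigma>\<close>. The threshold
    \<open>C = 2 * \<kappa> + e\<close> is the total coefficient of \<open>(norm b)^2\<close> that
    \<open>\<rho>\<close> has to dominate.\<close>
  define e where "e = 4 * \<tau> / \<delta>"
  define b where "b = a + g /\<^sub>R \<rho>"
  have e: "e > 0" and C: "C = 2 * \<kappa> + e" using pos by (auto simp: e_def C_def)
  have a: "a = b - g /\<^sub>R \<rho>" by (simp add: b_def)
  have te: "(norm t)\<^sup>2 / e \<le> \<delta> * \<sigma> / 4"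
    using t pos by (simp add: e_def field_simps)
  have square: "\<rho> * (norm a)\<^sup>2 + 2 * (a \<bullet> g) = \<rho> * (norm b)\<^sup>2 - (norm g)\<^sup>2 / \<rho>"
    using pos unfolding a
    unfolding power2_norm_eq_inner
    by (simp add: inner_simps inner_commute divide_inverse power2_eq_square) (simp add: field_simps)
  have na: "(norm a)\<^sup>2 \<le> 2 * (norm b)\<^sup>2 + 2 * (norm g)\<^sup>2 / \<rho>\<^sup>2"
  proof -
    have "0 \<le> (norm (b + g /\<^sub>R \<rho>))\<^sup>2" by simp
    also have "\<dots> = 2 * (norm b)\<^sup>2 + 2 * (norm g)\<^sup>2 / \<rho>\<^sup>2 - (norm a)\<^sup>2"
      using pos unfolding a
      unfolding power2_norm_eq_inner
    by (simp add: inner_simps inner_commute divide_inverse power2_eq_square)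
    finally show ?thesis by simp
  qed
  have bt: "- (2 * (b \<bullet> t)) \<le> e * (norm b)\<^sup>2 + \<delta> * \<sigma> / 4"
    using two_inner_le_weighted[OF e, of "- b" t] te
    unfolding inner_minus_left norm_minus_cancel by linarith
  have gt: "2 * (g \<bullet> t) / \<rho> \<le> e * (norm g)\<^sup>2 / \<rho>\<^sup>2 + \<delta> * \<sigma> / 4"
  proof -
    have "2 * ((g /\<^sub>R \<rho>) \<bullet> t) = 2 * (g \<bullet> t) / \<rho>"
      "e * (norm (g /\<^sub>R \<rho>))\<^sup>2 = e * (norm g)\<^sup>2 / \<rho>\<^sup>2"
      by (simp_all add: power_mult_distrib divide_inverse power_inverse)
    with two_inner_le_weighted[OF e, of "g /\<^sub>R \<rho>" t] te show ?thesis by linarith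
  qed
  have at: "a \<bullet> t = b \<bullet> t - (g \<bullet> t) / \<rho>"
    unfolding a by (simp add: inner_simps divide_inverse)
  have "\<kappa> * (norm a)\<^sup>2 \<le> \<kappa> * (2 * (norm b)\<^sup>2 + 2 * (norm g)\<^sup>2 / \<rho>\<^sup>2)"
    using na pos by (intro mult_left_mono)
  then have \<kappa>a: "\<kappa> * (norm a)\<^sup>2 \<le> 2 * \<kappa> * (norm b)\<^sup>2 + 2 * \<kappa> * (norm g)\<^sup>2 / \<rho>\<^sup>2"
    by (simp add: algebra_simps)
  have "C * (norm b)\<^sup>2 \<le> \<rho> * (norm b)\<^sup>2"
    using \<rho> by (intro mult_right_mono) (auto simp: C_def)
  then have \<rho>b: "2 * \<kappa> * (norm b)\<^sup>2 + e * (norm b)\<^sup>2 \<le> \<rho> * (norm b)\<^sup>2"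
    by (simp add: C algebra_simps)
  have "C * (norm g)\<^sup>2 / \<rho>\<^sup>2 \<le> C * (c * \<omega>) / \<rho>\<^sup>2"
    using g e pos C by (intro divide_right_mono mult_left_mono) auto
  then have Cg: "2 * \<kappa> * (norm g)\<^sup>2 / \<rho>\<^sup>2 + e * (norm g)\<^sup>2 / \<rho>\<^sup>2 \<le> c * C / \<rho>\<^sup>2 * \<omega>"
    by (simp add: C algebra_simps add_divide_distrib)
  have g\<rho>: "(norm g)\<^sup>2 / \<rho> \<le> c / \<rho> * \<omega>"
    using divide_right_mono[OF g, of \<rho>] pos by simp
  have "0 \<le> \<delta> * \<sigma>" using pos \<sigma> by simp
  then have "0 \<le> \<delta> * \<sigma> + 2 * (a \<bullet> g) + 2 * (a \<bullet> t) - \<kappa> * (norm a)\<^sup>2 + \<rho> * (norm a)\<^sup>2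
      + c / \<rho> * \<omega> + c * C / \<rho>\<^sup>2 * \<omega>"
    using square bt gt \<kappa>a \<rho>b Cg g\<rho> at by argo
  then show ?thesis by (simp add: C_def inner_add_right algebra_simps)
qed

lemma inner_self_expand:
  fixes H :: "real^'n^'n"
  assumes "transpose H = H"
  shows "(x + y) \<bullet> (H *v (x + y)) = x \<bullet> (H *v x) + 2 * (y \<bullet> (H *v x)) + y \<bullet> (H *v y)"
  using symmetric_inner_commute[OF assms, of x y]
  by (simp add: matrix_vector_right_distrib inner_simps inner_commute)

subsection \<open>The penalized eigenvalue problem\<close>

locale penalized_eigenproblem =
  fixes H :: "real^'n^'n" and A :: "real^'n^'m" and Z :: "real^'k^'n"
  assumes H_sym: "transpose H = H"
    and A_full_row_rank: "rank A = CARD('m)"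
    and Z_orthonormal: "orthonormal_columns Z"
    and Z_span: "span (columns Z) = null_space A"
begin

abbreviation "M \<equiv> reduced_matrix H Z"
abbreviation "lam \<equiv> reduced_value H Z"
abbreviation "E \<equiv> reduced_eigenspace H Z"
abbreviation "K \<equiv> shifted_matrix H Z"
text \<open>\<open>transpose A ** B\<close> is the Moore-Penrose right inverse of \<open>A\<close>:
  it lifts \<open>a\<close> to the solution of \<open>A *v x = a\<close> of least norm.\<close>

abbreviation "B \<equiv> matrix_inv (A ** transpose A)"
abbreviation "T \<equiv> B ** A ** H ** Z"

section \<open>Orthogonal splitting into the null space and the row space of A\<close>

lemma gram_invertible: "invertible (A ** transpose A)"
proof -
  have "inj ((*v) (transpose A))"
    using A_full_row_rank by (simp add: full_rank_injective[symmetric] rank_transpose)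
  then have inj: "transpose A *v y = 0 \<Longrightarrow> y = 0" for y
    by (metis injD matrix_vector_mult_0_right)
  have "y = 0" if "(A ** transpose A) *v y = 0" for y
  proof (rule inj)
    have "(transpose A *v y) \<bullet> (transpose A *v y) = 0"
      using that by (simp add: inner_transpose_mult matrix_vector_mul_assoc)
    then show "transpose A *v y = 0" by simp
  qed
  then show ?thesis
    unfolding invertible_left_inverse matrix_left_invertible_ker by blast
qed

lemma gram_inverse: "(A ** transpose A) ** B = mat 1" "B ** (A ** transpose A) = mat 1"
  using someI_ex[of "\<lambda>C. (A ** transpose A) ** C = mat 1 \<and> C ** (A ** transpose A) = mat 1"]
    gram_invertible unfolding invertible_def matrix_inv_def by auto

lemma B_sym: "transpose B = B"
proof -
  have "transpose B ** (A ** transpose A) = mat 1"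
    using arg_cong[OF gram_inverse(1), of transpose]
    by (simp add: matrix_transpose_mul transpose_mat)
  then show ?thesis
    by (metis gram_inverse(1) matrix_mul_assoc matrix_mul_lid matrix_mul_rid)
qed

lemma A_lift: "A *v (transpose A *v (B *v a)) = a"
  using gram_inverse(1) by (metis matrix_vector_mul_assoc matrix_vector_mul_lid)

lemma B_eq_0_iff: "B *v a = 0 \<longleftrightarrow> a = 0"
  by (metis A_lift matrix_vector_mult_0_right)

lemma A_Z: "A *v (Z *v u) = 0"
  using matrix_vector_mult_in_columnspace[of Z u] by (simp add: Z_span null_space_def)

lemma transpose_Z_Z: "transpose Z *v (Z *v u) = u"
  using Z_orthonormal by (simp add: orthonormal_columns_iff matrix_vector_mul_assoc)

lemma norm_Z: "norm (Z *v u) = norm u"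
  by (rule orthonormal_columns_norm[OF Z_orthonormal])

text \<open>\<open>Z ** transpose Z\<close> is the orthogonal projector onto the null space of
  \<open>A\<close>, hence fixes its vectors.\<close>

lemma null_A_eq_Z: "A *v x = 0 \<Longrightarrow> Z *v (transpose Z *v x) = x"
proof -
  assume "A *v x = 0"
  then have "x \<in> range ((*v) Z)"
    unfolding range_eq_span_columns Z_span by (simp add: null_space_def)
  then show ?thesis by (auto simp: transpose_Z_Z)
qed

lemma vector_decomposition:
  obtains u where "x = Z *v u + transpose A *v (B *v (A *v x))"
proof -
  have "A *v (x - transpose A *v (B *v (A *v x))) = 0"
    by (simp add: matrix_vector_mult_diff_distrib A_lift)
  from null_A_eq_Z[OF this]
  have "x = Z *v (transpose Z *v (x - transpose A *v (B *v (A *v x)))) + transpose A *v (B *v (A *v x))"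
    by (simp only: diff_add_cancel)
  then show thesis by (rule that)
qed

lemma inner_lift_Z: "(transpose A *v (B *v a)) \<bullet> (Z *v u) = 0"
  by (simp add: inner_transpose_mult A_Z)

lemma norm_decomposition:
  "(norm (Z *v u + transpose A *v (B *v a)))\<^sup>2 = (norm u)\<^sup>2 + (norm (transpose A *v (B *v a)))\<^sup>2"
  using inner_lift_Z[of a u] norm_Z[of u]
  by (simp add: power2_norm_eq_inner inner_simps inner_commute norm_eq)

lemma T_mult: "T *v u = B *v (A *v (H *v (Z *v u)))"
  by (simp add: matrix_vector_mul_assoc matrix_mul_assoc)

text \<open>This identifies \<open>T\<close> as the off-diagonal block of \<open>H\<close> in the
  splitting: the cross term of the quadratic form sees \<open>u\<close> only through
  \<open>T *v u\<close>.\<close>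

lemma inner_lift_H_Z: "(transpose A *v (B *v a)) \<bullet> (H *v (Z *v u)) = a \<bullet> (T *v u)"
  using symmetric_inner_commute[OF B_sym] by (simp add: T_mult inner_transpose_mult)

section \<open>The reduced matrix and its lowest eigenspace\<close>

lemma M_mult: "M *v u = transpose Z *v (H *v (Z *v u))"
  by (simp add: reduced_matrix_def matrix_vector_mul_assoc matrix_mul_assoc)

lemma inner_Z_H_Z: "(Z *v u) \<bullet> (H *v (Z *v u)) = u \<bullet> (M *v u)"
  using inner_transpose_mult[of Z "H *v (Z *v u)" u] by (simp add: M_mult inner_commute)

lemma M_sym: "transpose M = M"
  by (simp add: reduced_matrix_def matrix_transpose_mul H_sym matrix_mul_assoc)

lemma lam_le: "lam * (norm u)\<^sup>2 \<le> u \<bullet> (M *v u)"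
  unfolding reduced_value_def by (rule lambda_min_rayleigh_le[OF M_sym])

lemma E_iff: "w \<in> E \<longleftrightarrow> M *v w = lam *\<^sub>R w"
  by (simp add: reduced_eigenspace_def null_space_def diff_scaled_mat_mult)

lemma subspace_E: "subspace E"
  unfolding subspace_def by (auto simp: E_iff matrix_vector_right_distrib matrix_vector_mult_scaleR algebra_simps)

lemma K_mult: "K *v x = H *v x - lam *\<^sub>R x"
  by (simp add: shifted_matrix_def diff_scaled_mat_mult)

lemma K_sym: "transpose K = K"
  unfolding shifted_matrix_def by (rule transpose_diff_scaled_mat[OF H_sym])

section \<open>The penalized quadratic form and its minimum\<close>

definition penalized_form :: "real \<Rightarrow> real^'n \<Rightarrow> real" where
  "penalized_form \<rho> x = x \<bullet> (H *v x) + \<rho> * (norm (A *v x))\<^sup>2"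

lemma penalized_sym: "transpose (H + \<rho> *\<^sub>R (transpose A ** A)) = H + \<rho> *\<^sub>R (transpose A ** A)"
proof -
  have "transpose (transpose A ** A) = transpose A ** A"
    by (simp add: matrix_transpose_mul)
  then show ?thesis using H_sym by (simp add: transpose_def vec_eq_iff)
qed

lemma penalized_mult: "(H + \<rho> *\<^sub>R (transpose A ** A)) *v x = H *v x + \<rho> *\<^sub>R (transpose A *v (A *v x))"
  by (simp add: matrix_vector_mult_add_rdistrib scaleR_matrix_vector_assoc[symmetric] matrix_vector_mul_assoc)

lemma penalized_quadratic_form: "x \<bullet> ((H + \<rho> *\<^sub>R (transpose A ** A)) *v x) = penalized_form \<rho> x"
  using inner_transpose_mult[of A "A *v x" x]
  by (simp add: penalized_mult penalized_form_def inner_simps power2_norm_eq_inner inner_commute)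

lemma penalty_value_le: "penalty_value H A \<rho> * (norm x)\<^sup>2 \<le> penalized_form \<rho> x"
  using lambda_min_rayleigh_le[OF penalized_sym]
  by (simp add: penalty_value_def flip: penalized_quadratic_form)

lemma penalty_value_ge:
  assumes "\<And>x. l * (norm x)\<^sup>2 \<le> penalized_form \<rho> x"
  shows "l \<le> penalty_value H A \<rho>"
proof -
  obtain v where "norm v = 1" "v \<bullet> ((H + \<rho> *\<^sub>R (transpose A ** A)) *v v) = penalty_value H A \<rho>"
    unfolding penalty_value_def using eigenvalue_eq_rayleigh[OF lambda_min_in_eigenvalues[OF penalized_sym]] by blast
  with assms[of v] show ?thesis by (simp add: penalized_quadratic_form)
qed

lemma unit_vector_E: obtains w where "w \<in> E" "norm w = 1"
proof -
  obtain w where "norm w = 1" "M *v w = lam *\<^sub>R w"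
    using eigenvalue_eq_rayleigh[OF lambda_min_in_eigenvalues[OF M_sym]] unfolding reduced_value_def by blast
  then show thesis using that by (auto simp: E_iff)
qed

text \<open>Test vectors \<open>Z *v w\<close> pay no penalty, so the bound holds for every
  \<open>\<rho>\<close>, whatever its sign.\<close>

lemma penalty_value_le_lam: "penalty_value H A \<rho> \<le> lam"
proof -
  obtain w where w: "w \<in> E" "norm w = 1" by (rule unit_vector_E)
  have "penalty_value H A \<rho> * (norm (Z *v w))\<^sup>2 \<le> penalized_form \<rho> (Z *v w)" by (rule penalty_value_le)
  also have "\<dots> = lam"
    using w by (simp add: penalized_form_def A_Z inner_Z_H_Z E_iff flip: power2_norm_eq_inner)
  finally show ?thesis using w by (simp add: norm_Z)
qed

section \<open>Two-sided bounds on the smallest penalized eigenvalue\<close>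

lemma T_maximum:
  obtains c where "is_maximum c {(norm (T *v w))\<^sup>2 | w. w \<in> E \<and> norm w = 1}"
proof -
  have "compact (sphere 0 1 \<inter> E)"
    by (intro compact_Int_closed compact_sphere closed_subspace subspace_E)
  moreover have "sphere 0 1 \<inter> E \<noteq> {}"
  proof -
    obtain w where "w \<in> E" "norm w = 1" by (rule unit_vector_E)
    then have "w \<in> sphere 0 1 \<inter> E" by simp
    then show ?thesis by blast
  qed
  moreover have "continuous_on (sphere 0 1 \<inter> E) (\<lambda>w. (norm (T *v w))\<^sup>2)"
    by (intro continuous_intros matrix_vector_mult_linear_continuous_on)
  ultimately obtain v where "v \<in> sphere 0 1 \<inter> E" "\<forall>w\<in>sphere 0 1 \<inter> E. (norm (T *v w))\<^sup>2 \<le> (norm (T *v v))\<^sup>2"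
    using continuous_attains_sup by blast
  then show thesis by (intro that[of "(norm (T *v v))\<^sup>2"]) (auto simp: is_maximum_def)
qed

lemma penalty_value_lower_bound:
  assumes c: "\<And>w. w \<in> E \<Longrightarrow> (norm (T *v w))\<^sup>2 \<le> c * (norm w)\<^sup>2" and "c \<ge> 0"
  obtains C R where "C \<ge> 0" "R > 0"
    "\<And>\<rho>. \<rho> \<ge> R \<Longrightarrow> lam - c / \<rho> - c * C / \<rho>\<^sup>2 \<le> penalty_value H A \<rho>"
proof -
  let ?N = "M - lam *\<^sub>R mat 1"
  have Nsym: "transpose ?N = ?N" by (rule transpose_diff_scaled_mat[OF M_sym])
  have Nform: "x \<bullet> (?N *v x) = x \<bullet> (M *v x) - lam * (norm x)\<^sup>2" for x
    by (simp add: diff_scaled_mat_mult inner_simps power2_norm_eq_inner)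
  obtain \<delta> where \<delta>: "\<delta> > 0"
    and gap: "\<And>s. (\<forall>w\<in>null_space ?N. s \<bullet> w = 0) \<Longrightarrow> \<delta> * (norm s)\<^sup>2 \<le> s \<bullet> (?N *v s)"
    using psd_spectral_gap[OF Nsym] lam_le unfolding Nform by (metis diff_ge_0_iff_ge)
  obtain t where t: "t > 0" "\<And>u. norm (T *v u) \<le> t * norm u"
    using matrix_vector_mult_bound[of T] by blast
  obtain k where k: "k > 0" "\<And>x. norm (K *v x) \<le> k * norm x"
    using matrix_vector_mult_bound[of K] by blast
  obtain p where p: "p > 0" "\<And>a. norm ((transpose A ** B) *v a) \<le> p * norm a"
    using matrix_vector_mult_bound[of "transpose A ** B"] by blast
  \<comment> \<open>\<open>\<tau>\<close> controls \<open>T *v s\<close> by the size of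
    \<open>s\<close>, and \<open>\<kappa>\<close> controls the form of \<open>K\<close> on a lifted
    vector by the size of \<open>a\<close>; \<open>C\<close> is the resulting constant of
    \<open>completed_square_bound\<close> and also serves as the threshold \<open>R\<close>.\<close>
  define \<tau> where "\<tau> = t\<^sup>2"
  define \<kappa> where "\<kappa> = k * p\<^sup>2"
  define C where "C = 2 * \<kappa> + 4 * \<tau> / \<delta>"
  have pos: "\<tau> > 0" "\<kappa> > 0" "C > 0" using t k p \<delta> by (auto simp: \<tau>_def \<kappa>_def C_def intro!: add_pos_pos)
  have "lam - c / \<rho> - c * C / \<rho>\<^sup>2 \<le> penalty_value H A \<rho>" if \<rho>: "\<rho> \<ge> C" for \<rho>
  proof (rule penalty_value_ge)
    fix x
    define a where "a = A *v x"
    define h where "h = transpose A *v (B *v a)"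
    define \<epsilon> where "\<epsilon> = c / \<rho> + c * C / \<rho>\<^sup>2"
    have \<epsilon>: "\<epsilon> \<ge> 0" using \<open>c \<ge> 0\<close> \<rho> pos by (simp add: \<epsilon>_def)
    obtain u where x: "x = Z *v u + h"
      using vector_decomposition[of x] by (auto simp: a_def h_def)
    obtain w s where w: "w \<in> E" and s: "\<And>v. v \<in> E \<Longrightarrow> s \<bullet> v = 0" and u: "u = s + w"
      using orthogonal_subspace_decomp_exists[of E u] span_eq_iff[THEN iffD2, OF subspace_E]
      by (metis add.commute orthogonal_def)
    have nu: "(norm u)\<^sup>2 = (norm s)\<^sup>2 + (norm w)\<^sup>2"
      using s[OF w] by (simp add: u power2_norm_eq_inner inner_simps inner_commute)
    have nx: "(norm x)\<^sup>2 = (norm s)\<^sup>2 + (norm w)\<^sup>2 + (norm h)\<^sup>2"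
      unfolding x h_def norm_decomposition nu by simp
    \<comment> \<open>The cross term between \<open>s\<close> and \<open>w\<close> vanishes because
      \<open>M *v w\<close> is a multiple of \<open>w\<close>; the gap then applies to
      \<open>s\<close> alone.\<close>
    have Mu: "lam * (norm u)\<^sup>2 + \<delta> * (norm s)\<^sup>2 \<le> u \<bullet> (M *v u)"
    proof -
      have "\<delta> * (norm s)\<^sup>2 \<le> s \<bullet> (?N *v s)"
        by (rule gap) (use s in \<open>auto simp: reduced_eigenspace_def\<close>)
      also have "\<dots> = s \<bullet> (M *v s) - lam * (norm s)\<^sup>2" by (rule Nform)
      finally have "\<delta> * (norm s)\<^sup>2 \<le> s \<bullet> (M *v s) - lam * (norm s)\<^sup>2" .
      moreover have "u \<bullet> (M *v u) = s \<bullet> (M *v s) + lam * (norm w)\<^sup>2"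
        using inner_self_expand[OF M_sym, of w s] w s[OF w]
        by (simp add: u E_iff add.commute power2_norm_eq_inner)
      ultimately show ?thesis by (simp add: nu algebra_simps)
    qed
    have Hh: "lam * (norm h)\<^sup>2 - \<kappa> * (norm a)\<^sup>2 \<le> h \<bullet> (H *v h)"
    proof -
      have "norm h \<le> p * norm a" using p(2)[of a] by (simp add: h_def matrix_vector_mul_assoc)
      then have "(norm h)\<^sup>2 \<le> p\<^sup>2 * (norm a)\<^sup>2"
        using power_mono[of "norm h" "p * norm a" 2] by (simp add: power_mult_distrib)
      have "\<bar>h \<bullet> (K *v h)\<bar> \<le> norm h * (k * norm h)"
        using Cauchy_Schwarz_ineq2[of h "K *v h"] k(2)[of h] mult_left_mono[OF k(2)[of h], of "norm h"]
        by simp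
      also have "\<dots> = k * (norm h)\<^sup>2" by (simp add: power2_eq_square)
      also have "\<dots> \<le> \<kappa> * (norm a)\<^sup>2"
        using mult_left_mono[OF \<open>(norm h)\<^sup>2 \<le> p\<^sup>2 * (norm a)\<^sup>2\<close>, of k] k(1) by (simp add: \<kappa>_def)
      finally show ?thesis by (simp add: K_mult inner_simps power2_norm_eq_inner)
    qed
    have Tu: "T *v u = T *v w + T *v s" by (simp only: u matrix_vector_right_distrib add.commute)
    have "(norm (T *v s))\<^sup>2 \<le> \<tau> * (norm s)\<^sup>2"
      using power_mono[OF t(2)[of s], of 2] by (simp add: power_mult_distrib \<tau>_def)
    from completed_square_bound[OF c[OF w] this, of \<delta> \<kappa> \<rho> a]
    have "0 \<le> \<delta> * (norm s)\<^sup>2 + 2 * (a \<bullet> (T *v u)) - \<kappa> * (norm a)\<^sup>2 + \<rho> * (norm a)\<^sup>2 + \<epsilon> * (norm w)\<^sup>2"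
      using \<delta> pos \<rho> unfolding Tu \<epsilon>_def C_def by simp
    moreover have "penalized_form \<rho> x = u \<bullet> (M *v u) + 2 * (a \<bullet> (T *v u)) + h \<bullet> (H *v h) + \<rho> * (norm a)\<^sup>2"
    proof -
      have "x \<bullet> (H *v x) = u \<bullet> (M *v u) + 2 * (h \<bullet> (H *v (Z *v u))) + h \<bullet> (H *v h)"
        unfolding x inner_self_expand[OF H_sym] inner_Z_H_Z ..
      also have "h \<bullet> (H *v (Z *v u)) = a \<bullet> (T *v u)"
        unfolding h_def by (rule inner_lift_H_Z)
      finally show ?thesis by (simp only: penalized_form_def a_def)
    qed
    \<comment> \<open>The loss so far is proportional to \<open>(norm w)^2\<close> only; enlarging
      it to \<open>(norm x)^2\<close> gives a Rayleigh bound.\<close>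
    moreover have "0 \<le> \<epsilon> * (norm s)\<^sup>2" "0 \<le> \<epsilon> * (norm h)\<^sup>2" using \<epsilon> by simp_all
    moreover have "lam * (norm x)\<^sup>2 = lam * (norm u)\<^sup>2 + lam * (norm h)\<^sup>2"
      "\<epsilon> * (norm x)\<^sup>2 = \<epsilon> * (norm s)\<^sup>2 + \<epsilon> * (norm w)\<^sup>2 + \<epsilon> * (norm h)\<^sup>2"
      unfolding nx nu by (simp_all only: distrib_left add.assoc)
    ultimately have "lam * (norm x)\<^sup>2 - \<epsilon> * (norm x)\<^sup>2 \<le> penalized_form \<rho> x"
      using Mu Hh by linarith
    then show "(lam - c / \<rho> - c * C / \<rho>\<^sup>2) * (norm x)\<^sup>2 \<le> penalized_form \<rho> x"
      by (simp add: \<epsilon>_def algebra_simps)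
  qed
  then show thesis using pos by (intro that[of C C]) auto
qed


text \<open>The test vector \<open>Z w - A\<^sup>T B T w / \<rho>\<close> is the first-order
  approximation of the penalized eigenvector.\<close>

lemma penalty_value_upper_bound:
  assumes w: "w \<in> E" "norm w = 1" and Tw: "(norm (T *v w))\<^sup>2 = c"
  obtains D e where "D \<ge> 0"
    "\<And>\<rho>. \<rho> > 0 \<Longrightarrow> penalty_value H A \<rho> * (1 + D / \<rho>\<^sup>2) \<le> lam - c / \<rho> + e / \<rho>\<^sup>2"
proof
  define g where "g = T *v w"
  define h where "h = transpose A *v (B *v g)"
  \<comment> \<open>This fixes \<open>D\<close> as the squared norm of \<open>h\<close>, the excess
    in the norm of the test vector. The matching \<open>e\<close> is
    \<open>h \<bullet> (H *v h)\<close>.\<close>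
  show "0 \<le> (norm h)\<^sup>2" by simp
  fix \<rho> :: real assume \<rho>: "\<rho> > 0"
  define y where "y = transpose A *v (B *v ((- (1 / \<rho>)) *\<^sub>R g))"
  have y: "y = (- (1 / \<rho>)) *\<^sub>R h"
    unfolding y_def h_def by (simp only: matrix_vector_mult_scaleR)
  have gg: "g \<bullet> (T *v w) = c" using Tw by (simp add: g_def power2_norm_eq_inner)
  have nx: "(norm (Z *v w + y))\<^sup>2 = 1 + (norm h)\<^sup>2 / \<rho>\<^sup>2"
    using norm_decomposition[of w "(- (1 / \<rho>)) *\<^sub>R g"] w
    unfolding y_def[symmetric] by (simp add: y power_mult_distrib power_divide)
  have Ax: "A *v (Z *v w + y) = (- (1 / \<rho>)) *\<^sub>R g"
    unfolding y_def by (simp only: matrix_vector_right_distrib A_Z A_lift add_0)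
  have "(Z *v w + y) \<bullet> (H *v (Z *v w + y)) = lam - 2 * c / \<rho> + h \<bullet> (H *v h) / \<rho>\<^sup>2"
  proof -
    have "y \<bullet> (H *v (Z *v w)) = - c / \<rho>"
      using gg unfolding y_def inner_lift_H_Z inner_scaleR_left by simp
    moreover have "w \<bullet> (M *v w) = lam"
      using w by (simp add: E_iff flip: power2_norm_eq_inner)
    moreover have "y \<bullet> (H *v y) = h \<bullet> (H *v h) / \<rho>\<^sup>2"
      unfolding y matrix_vector_mult_scaleR by (simp add: power2_eq_square)
    ultimately show ?thesis unfolding inner_self_expand[OF H_sym] inner_Z_H_Z by simp
  qed
  moreover have "\<rho> * (norm (A *v (Z *v w + y)))\<^sup>2 = c / \<rho>"
    using \<rho> Tw unfolding Ax by (simp add: power_mult_distrib g_def power2_eq_square)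
  \<comment> \<open>The cross term contributes \<open>- 2 * c / \<rho>\<close> and the penalty
    returns \<open>c / \<rho>\<close>.\<close>
  ultimately have "penalized_form \<rho> (Z *v w + y) = lam - c / \<rho> + h \<bullet> (H *v h) / \<rho>\<^sup>2"
    unfolding penalized_form_def by (simp add: field_simps)
  with penalty_value_le[of \<rho> "Z *v w + y"] nx
  show "penalty_value H A \<rho> * (1 + (norm h)\<^sup>2 / \<rho>\<^sup>2) \<le> lam - c / \<rho> + h \<bullet> (H *v h) / \<rho>\<^sup>2"
    by simp
qed

section \<open>Asymptotic expansion with the extremal coefficient\<close>

context
  fixes c :: real
  assumes c_max: "is_maximum c {(norm (T *v w))\<^sup>2 | w. w \<in> E \<and> norm w = 1}"
begin

lemma c_nonneg: "c \<ge> 0"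
  using c_max by (auto simp: is_maximum_def)

lemma T_le_on_E:
  assumes w: "w \<in> E"
  shows "(norm (T *v w))\<^sup>2 \<le> c * (norm w)\<^sup>2"
proof (cases "w = 0")
  case False
  have "w /\<^sub>R norm w \<in> E" using w by (intro subspace_mul subspace_E)
  moreover have "norm (w /\<^sub>R norm w) = 1" using False by simp
  ultimately have "(norm (T *v (w /\<^sub>R norm w)))\<^sup>2 \<le> c"
    using c_max unfolding is_maximum_def by blast
  then have "(norm (T *v w))\<^sup>2 / (norm w)\<^sup>2 \<le> c"
    unfolding matrix_vector_mult_scaleR by (simp add: power_mult_distrib power_inverse divide_inverse mult.commute)
  then show ?thesis using False by (simp add: field_simps)
qed simp

lemma penalty_value_asymptotics:
  "(\<lambda>\<rho>. penalty_value H A \<rho> - (lam - c / \<rho>)) \<in> O[at_top](\<lambda>\<rho>. 1 / \<rho>\<^sup>2)"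
proof -
  obtain w where w: "w \<in> E" "norm w = 1" "(norm (T *v w))\<^sup>2 = c"
    using c_max by (auto simp: is_maximum_def)
  obtain C R where C: "C \<ge> 0" "R > 0"
    and lower: "\<And>\<rho>. \<rho> \<ge> R \<Longrightarrow> lam - c / \<rho> - c * C / \<rho>\<^sup>2 \<le> penalty_value H A \<rho>"
    using penalty_value_lower_bound[OF T_le_on_E c_nonneg] by blast
  obtain D e where D: "D \<ge> 0"
    and upper: "\<And>\<rho>. \<rho> > 0 \<Longrightarrow> penalty_value H A \<rho> * (1 + D / \<rho>\<^sup>2) \<le> lam - c / \<rho> + e / \<rho>\<^sup>2"
    using penalty_value_upper_bound[OF w] by blast
  \<comment> \<open>The factor \<open>1 + D / \<rho>^2\<close> in the upper bound can be removed
    only with control of the eigenvalue from below, since it may be negative; \<open>- L\<close> is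
    such a lower bound once \<open>\<rho>\<close> is at least \<open>max R 1\<close>.
    \<open>Q\<close> adds up the three second-order errors.\<close>
  define L where "L = \<bar>lam\<bar> + c + c * C"
  define Q where "Q = \<bar>e\<bar> + D * L + c * C"
  have cC: "0 \<le> c * C" using C c_nonneg by simp
  have "\<bar>penalty_value H A \<rho> - (lam - c / \<rho>)\<bar> \<le> Q * \<bar>1 / \<rho>\<^sup>2\<bar>" if \<rho>: "\<rho> \<ge> max R 1" for \<rho>
  proof -
    let ?f = "penalty_value H A \<rho>"
    have \<rho>1: "\<rho> \<ge> 1" "\<rho> \<ge> R" "\<rho> > 0" "\<rho>\<^sup>2 \<ge> 1" using \<rho> by auto
    have "c / \<rho> \<le> c" "c * C / \<rho>\<^sup>2 \<le> c * C"
      using \<rho>1 c_nonneg cC by (simp_all add: divide_le_eq mult_left_le mult_le_cancel_left1 le_divide_eq)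
    with lower[OF \<rho>1(2)] have "- L \<le> ?f" by (simp add: L_def)
    then have "- (D * L) \<le> D * ?f" using mult_left_mono[OF _ D] by fastforce
    then have "- (D * L / \<rho>\<^sup>2) \<le> D * ?f / \<rho>\<^sup>2" using divide_right_mono[of "- (D * L)" "D * ?f" "\<rho>\<^sup>2"] by simp
    moreover have "?f + D * ?f / \<rho>\<^sup>2 \<le> lam - c / \<rho> + e / \<rho>\<^sup>2"
      using upper[OF \<rho>1(3)] by (simp add: algebra_simps)
    moreover have "e / \<rho>\<^sup>2 \<le> \<bar>e\<bar> / \<rho>\<^sup>2" by (simp add: divide_right_mono)
    moreover have "0 \<le> \<bar>e\<bar> / \<rho>\<^sup>2" "0 \<le> D * L / \<rho>\<^sup>2" "0 \<le> c * C / \<rho>\<^sup>2"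
      using D cC c_nonneg by (simp_all add: L_def)
    moreover have Q: "Q * \<bar>1 / \<rho>\<^sup>2\<bar> = \<bar>e\<bar> / \<rho>\<^sup>2 + D * L / \<rho>\<^sup>2 + c * C / \<rho>\<^sup>2"
      by (simp add: Q_def add_divide_distrib)
    ultimately show ?thesis
      using lower[OF \<rho>1(2)] unfolding Q abs_le_iff by argo
  qed
  then show ?thesis
    by (intro bigoI[where c = Q]) (auto simp: eventually_at_top_linorder intro!: exI[of _ "max R 1"])
qed

section \<open>Vanishing of the coefficient and finite attainability\<close>

lemma null_space_K: "null_space (transpose Z ** K ** Z) = E"
proof -
  have "(transpose Z ** K ** Z) *v w = M *v w - lam *\<^sub>R w" for w
    by (simp add: K_mult M_mult transpose_Z_Z matrix_vector_mult_diff_distrib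
        matrix_vector_mult_scaleR flip: matrix_vector_mul_assoc)
  then show ?thesis by (auto simp: null_space_def E_iff)
qed

text \<open>Pairing the image of \<open>w\<close> with \<open>w\<close> gives the squared norm of
  \<open>K *v (Z *v w)\<close>.\<close>

lemma null_space_K_square: "w \<in> null_space (transpose Z ** (K ** K) ** Z) \<longleftrightarrow> K *v (Z *v w) = 0"
proof -
  have eq: "(transpose Z ** (K ** K) ** Z) *v w = transpose Z *v (K *v (K *v (Z *v w)))"
    by (simp flip: matrix_vector_mul_assoc)
  have "w \<bullet> (transpose Z *v (K *v (K *v (Z *v w)))) = (K *v (Z *v w)) \<bullet> (K *v (Z *v w))"
    using inner_transpose_mult[of Z "K *v (K *v (Z *v w))" w]
      symmetric_inner_commute[OF K_sym, of "K *v (Z *v w)" "Z *v w"]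
    by (simp add: inner_commute)
  then show ?thesis
    by (auto simp: null_space_def eq)
qed

text \<open>For \<open>w\<close> in \<open>E\<close> the vector \<open>K *v (Z *v w)\<close> has no
  component in the null space of \<open>A\<close>, so it vanishes exactly when \<open>A\<close>
  kills it. There \<open>K\<close> may be replaced by \<open>H\<close>, and \<open>B\<close> is
  injective.\<close>

lemma K_Z_eq_0_iff:
  assumes w: "w \<in> E"
  shows "K *v (Z *v w) = 0 \<longleftrightarrow> T *v w = 0"
proof -
  have "A *v (K *v (Z *v w)) = A *v (H *v (Z *v w))"
    by (simp add: K_mult matrix_vector_mult_diff_distrib matrix_vector_mult_scaleR A_Z)
  then have T: "T *v w = 0 \<longleftrightarrow> A *v (K *v (Z *v w)) = 0"
    by (simp add: T_mult B_eq_0_iff)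
  have "transpose Z *v (K *v (Z *v w)) = 0"
    using w unfolding null_space_K[symmetric] by (simp add: null_space_def flip: matrix_vector_mul_assoc)
  then show ?thesis
    using null_A_eq_Z[of "K *v (Z *v w)"] unfolding T by auto
qed

lemma c_eq_0_iff_T: "c = 0 \<longleftrightarrow> (\<forall>w\<in>E. T *v w = 0)"
proof
  assume "c = 0"
  then show "\<forall>w\<in>E. T *v w = 0" using T_le_on_E by auto
next
  assume "\<forall>w\<in>E. T *v w = 0"
  then show "c = 0" using c_max by (auto simp: is_maximum_def)
qed

lemma c_eq_0_iff_annihilates: "c = 0 \<longleftrightarrow> shifted_matrix_annihilates H Z"
  unfolding c_eq_0_iff_T shifted_matrix_annihilates_def
  by (simp add: K_Z_eq_0_iff flip: matrix_vector_mul_assoc)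

lemma c_eq_0_iff_null_spaces: "c = 0 \<longleftrightarrow> null_spaces_agree H Z"
proof -
  have "null_space (transpose Z ** (K ** K) ** Z) \<subseteq> E"
    unfolding null_space_K[symmetric] subset_iff null_space_K_square
    by (simp add: null_space_def flip: matrix_vector_mul_assoc)
  then have "null_spaces_agree H Z \<longleftrightarrow> (\<forall>w\<in>E. K *v (Z *v w) = 0)"
    unfolding null_spaces_agree_def Let_def null_space_K using null_space_K_square by blast
  then show ?thesis unfolding c_eq_0_iff_T by (simp add: K_Z_eq_0_iff)
qed

text \<open>If \<open>c = 0\<close>, both error terms of the lower bound vanish and it meets the
  upper bound \<open>lam\<close>. Conversely, attainment makes every \<open>Z *v w\<close> with
  \<open>w\<close> in \<open>E\<close> a minimizer of the penalized Rayleigh quotient, hence an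
  eigenvector; the penalty vanishes on it, leaving \<open>K *v (Z *v w) = 0\<close>.\<close>

lemma c_eq_0_iff_attained: "c = 0 \<longleftrightarrow> attained_at_finite_parameter H A Z"
proof
  assume "c = 0"
  obtain C R where "\<And>\<rho>. \<rho> \<ge> R \<Longrightarrow> lam - c / \<rho> - c * C / \<rho>\<^sup>2 \<le> penalty_value H A \<rho>"
    using penalty_value_lower_bound[OF T_le_on_E c_nonneg] by blast
  from this[of R] have "penalty_value H A R = lam"
    using penalty_value_le_lam[of R] \<open>c = 0\<close> by simp
  then show "attained_at_finite_parameter H A Z" by (auto simp: attained_at_finite_parameter_def)
next
  assume "attained_at_finite_parameter H A Z"
  then obtain \<rho> where \<rho>: "penalty_value H A \<rho> = lam" by (auto simp: attained_at_finite_parameter_def)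
  show "c = 0"
    unfolding c_eq_0_iff_annihilates shifted_matrix_annihilates_def
  proof
    fix w assume w: "w \<in> E"
    have "(H + \<rho> *\<^sub>R (transpose A ** A)) *v (Z *v w) = lam *\<^sub>R (Z *v w)"
    proof (rule rayleigh_minimizer_eigenvector[OF penalized_sym])
      show "lam * (norm x)\<^sup>2 \<le> x \<bullet> ((H + \<rho> *\<^sub>R (transpose A ** A)) *v x)" for x
        using penalty_value_le[of \<rho> x] by (simp add: \<rho> penalized_quadratic_form)
      show "(Z *v w) \<bullet> ((H + \<rho> *\<^sub>R (transpose A ** A)) *v (Z *v w)) = lam * (norm (Z *v w))\<^sup>2"
        using w unfolding penalized_quadratic_form
        by (simp add: penalized_form_def A_Z inner_Z_H_Z E_iff norm_Z flip: power2_norm_eq_inner)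
    qed
    then show "(K ** Z) *v w = 0"
      by (simp add: penalized_mult A_Z K_mult flip: matrix_vector_mul_assoc)
  qed
qed

section \<open>Closed formulas for the coefficient\<close>

lemma c_eq_lambda_max:
  fixes W :: "real^'r^'k"
  assumes W: "orthonormal_columns W" and span: "span (columns W) = E"
  shows "c = lambda_max (transpose W ** transpose Z ** H ** transpose A ** (B ** B) ** A ** H ** Z ** W)"
proof -
  define N where "N = transpose W ** transpose Z ** H ** transpose A ** (B ** B) ** A ** H ** Z ** W"
  \<comment> \<open>As a Gram matrix, \<open>N\<close> has the form
    \<open>(norm (T *v (W *v y)))^2\<close>, and the isometry \<open>W\<close> carries the unit
    sphere onto that of \<open>E\<close>.\<close>
  have N: "N = transpose (T ** W) ** (T ** W)"
    by (simp add: N_def matrix_transpose_mul B_sym H_sym matrix_mul_assoc)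
  have form: "y \<bullet> (N *v y) = (norm (T *v (W *v y)))\<^sup>2" for y
  proof -
    have "N *v y = transpose (T ** W) *v ((T ** W) *v y)"
      unfolding N by (rule matrix_vector_mul_assoc[symmetric])
    then have "y \<bullet> (N *v y) = ((T ** W) *v y) \<bullet> ((T ** W) *v y)"
      by (simp only: inner_transpose_mult inner_commute[of y])
    then show ?thesis
      by (simp only: power2_norm_eq_inner matrix_vector_mul_assoc)
  qed
  have "transpose N = N"
    unfolding N by (simp only: matrix_transpose_mul transpose_transpose)
  moreover have "{y \<bullet> (N *v y) | y. norm y = 1} = {(norm (T *v w))\<^sup>2 | w. w \<in> E \<and> norm w = 1}"
  proof -
    have "{w. w \<in> E \<and> norm w = 1} = (*v) W ` {y. norm y = 1}"
      unfolding span[symmetric] range_eq_span_columns[symmetric]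
      by (auto simp: orthonormal_columns_norm[OF W])
    then show ?thesis unfolding form by (auto simp: set_eq_iff image_iff)
  qed
  ultimately have "lambda_max N = c"
    using c_max by (intro lambda_max_eqI) simp_all
  then show ?thesis by (simp add: N_def)
qed

text \<open>Simplicity makes the eigenspace a line, so a maximizer is \<open>v\<close> or
  \<open>- v\<close>, and both give the same norm.\<close>

lemma c_simple:
  assumes simple: "simple_eigenvalue M lam" and v: "M *v v = lam *\<^sub>R v" "norm v = 1"
  shows "c = (norm (T *v v))\<^sup>2"
proof -
  obtain w where w: "w \<in> E" "norm w = 1" "(norm (T *v w))\<^sup>2 = c"
    using c_max by (auto simp: is_maximum_def)
  have "w = v \<or> w = - v"
  proof (cases "w = v")
    case False
    then have "dependent {w, v}"
      using simple_eigenvalue_eigenvectors_dependent[OF M_sym simple _ v(1), of w] w by (simp add: E_iff)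
    moreover have "independent {v}" using v(2) by auto
    ultimately have "w \<in> span {v}"
      using False independent_insert[of w "{v}"] by auto
    then obtain a where "w = a *\<^sub>R v" by (auto simp: span_singleton)
    then show ?thesis using w(2) v(2) by (auto simp: abs_if split: if_splits)
  qed simp
  moreover have "T *v (- v) = - (T *v v)"
    using matrix_vector_mult_scaleR[of T "- 1" v] by simp
  ultimately show ?thesis using w(3) by auto
qed

end

end

theorem theorem3p6:
  fixes H :: "real^'n^'n" and A :: "real^'n^'m" and Z :: "real^'k^'n"
    and f :: "real \<Rightarrow> real" and lam :: real and E :: "(real^'k) set" and B :: "real^'m^'m"
  assumes H_sym: "transpose H = H"
    and A_full_row_rank: "rank A = CARD('m)"
    and m_less_n: "CARD('m) < CARD('n)"
    and k_eq: "CARD('k) = CARD('n) - CARD('m)"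
    and Z_orthonormal: "orthonormal_columns Z"
    and Z_span: "span (columns Z) = null_space A"
  defines "f \<equiv> penalty_value H A"
    and "lam \<equiv> reduced_value H Z"
    and "E \<equiv> reduced_eigenspace H Z"
    and "B \<equiv> matrix_inv (A ** transpose A)"
  shows "\<exists>c.
      (\<lambda>\<rho>. f \<rho> - (lam - c / \<rho>)) \<in> O[at_top](\<lambda>\<rho>. 1 / \<rho>^2)
    \<and> (\<forall>W :: real^'r^'k.
         CARD('r) = dim E \<and> orthonormal_columns W \<and> span (columns W) = E \<longrightarrow>
         c = lambda_max (transpose W ** transpose Z ** H ** transpose A ** (B ** B)
                           ** A ** H ** Z ** W))
    \<and> is_maximum c {(norm ((B ** A ** H ** Z) *v w))^2 | w. w \<in> E \<and> norm w = 1}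
    \<and> 0 \<le> c
    \<and> (c = 0 \<longleftrightarrow> attained_at_finite_parameter H A Z)
    \<and> (c = 0 \<longleftrightarrow> shifted_matrix_annihilates H Z)
    \<and> (c = 0 \<longleftrightarrow> null_spaces_agree H Z)
    \<and> (\<not> attained_at_finite_parameter H A Z \<or> \<not> shifted_matrix_annihilates H Z
         \<or> \<not> null_spaces_agree H Z \<longrightarrow>
         0 < c \<and> (\<lambda>\<rho>. (lam - f \<rho>) - c / \<rho>) \<in> O[at_top](\<lambda>\<rho>. 1 / \<rho>^2))
    \<and> (simple_eigenvalue (reduced_matrix H Z) lam \<longrightarrow>
         (\<forall>v. reduced_matrix H Z *v v = lam *\<^sub>R v \<and> norm v = 1 \<longrightarrow>
            (let x = Z *v v in
               c = (H *v x) \<bullet> ((transpose A ** (B ** B) ** A) *v (H *v x))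
             \<and> c = (norm ((B ** A) *v (H *v x)))^2)))"
proof -
  interpret penalized_eigenproblem H A Z
    by unfold_locales (fact H_sym A_full_row_rank Z_orthonormal Z_span)+
  obtain c where c: "is_maximum c {(norm (T *v w))\<^sup>2 | w. w \<in> reduced_eigenspace H Z \<and> norm w = 1}"
    by (rule T_maximum)
  note asym = penalty_value_asymptotics[OF c]
  have "(\<lambda>\<rho>. - (penalty_value H A \<rho> - (reduced_value H Z - c / \<rho>))) \<in> O[at_top](\<lambda>\<rho>. 1 / \<rho>\<^sup>2)"
    using asym by (simp only: landau_o.big.uminus_in_iff)
  then have asym': "(\<lambda>\<rho>. (reduced_value H Z - penalty_value H A \<rho>) - c / \<rho>) \<in> O[at_top](\<lambda>\<rho>. 1 / \<rho>\<^sup>2)"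
    by (simp add: algebra_simps)
  have simple: "c = (H *v (Z *v v)) \<bullet> ((transpose A ** (B ** B) ** A) *v (H *v (Z *v v)))"
      "c = (norm ((B ** A) *v (H *v (Z *v v))))\<^sup>2"
    if s: "simple_eigenvalue (reduced_matrix H Z) lam"
      and v: "reduced_matrix H Z *v v = lam *\<^sub>R v" "norm v = 1" for v
  proof -
    have *: "c = (norm (B *v (A *v (H *v (Z *v v)))))\<^sup>2"
      using c_simple[OF c s[unfolded lam_def] v[unfolded lam_def]] unfolding T_mult B_def .
    then show "c = (norm ((B ** A) *v (H *v (Z *v v))))\<^sup>2"
      by (simp flip: matrix_vector_mul_assoc)
    define y where "y = H *v (Z *v v)"
    \<comment> \<open>Moving \<open>transpose A\<close> and one symmetric factor \<open>B\<close>
      across the inner product turns the quadratic form into a squared norm.\<close>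
    have "y \<bullet> ((transpose A ** (B ** B) ** A) *v y) = y \<bullet> (transpose A *v (B *v (B *v (A *v y))))"
      by (simp flip: matrix_vector_mul_assoc)
    also have "\<dots> = (B *v (A *v y)) \<bullet> (B *v (A *v y))"
      using inner_transpose_mult[of A "B *v (B *v (A *v y))" y]
        symmetric_inner_commute[OF B_sym, of "B *v (A *v y)" "A *v y"]
      by (simp add: inner_commute B_def)
    finally show "c = (H *v (Z *v v)) \<bullet> ((transpose A ** (B ** B) ** A) *v (H *v (Z *v v)))"
      using * by (simp add: y_def power2_norm_eq_inner)
  qed
  show ?thesis
    unfolding Let_def
    using asym asym' c c_nonneg[OF c] c_eq_0_iff_attained[OF c] c_eq_0_iff_annihilates[OF c]
      c_eq_0_iff_null_spaces[OF c] c_eq_lambda_max[OF c] simple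
    unfolding f_def lam_def E_def B_def
    by (intro exI[of _ c] conjI allI impI) (auto simp: less_le)
qed

end
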